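(* Let $X\neq\{0\}$ be a real Hilbert space and let $e\in X$ satisfy $\|e\|<1$. Then the maximally monotone operator $A_e$ is given by $$(\forall x\in X)\quad A_e x = x+\frac{2\langle e,x\rangle-2\sqrt{(1-\|e\|^2)\|x\|^2+\langle e,x\rangle^2}}{1-\|e\|^2}\, e .$$
   Context: For $e$ in a real Hilbert space $X\ne\{0\}$ with $\|e\|\le 1$, define $R_e\colon X\to X\colon x\mapsto \|x\|\,e$ and $T_e\colon X\to X\colon x\mapsto \tfrac12 x+\tfrac12 R_e x=\tfrac12x+\tfrac12\|x\|e$. The map $R_e$ is nonexpansive, so $T_e$ is firmly nonexpansive and is the resolvent $J_{A_e}=(\mathrm{Id}+A_e)^{-1}$ of the maximally monotone set-valued operator $A_e=T_e^{-1}-\mathrm{Id}$ (inverse in the sense of set-valued operators); equivalently, the graph of $A_e$ is $\{(T_ey,\,y-T_ey) : y\in X\}$. The displayed vector stands for the singleton containing it (so the claim includes that $A_e$ is single-valued with full domain). *)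

theory Defs
  imports "HOL-Analysis.Analysis"
begin

text \<open>
  A real Hilbert space is a type of sort \<open>{real_inner, complete_space}\<close>, and a set-valued
  operator \<open>X \<rightrightarrows> X\<close> is a function \<open>'a \<Rightarrow> 'a set\<close>.
\<close>

type_synonym 'a svop = "'a \<Rightarrow> 'a set"

definition svop_graph :: "'a svop \<Rightarrow> ('a \<times> 'a) set" where
  "svop_graph A = {(x, u). u \<in> A x}"

definition svop_of :: "('a \<Rightarrow> 'a) \<Rightarrow> 'a svop" where
  "svop_of f = (\<lambda>x. {f x})"

definition svop_inverse :: "'a svop \<Rightarrow> 'a svop" where
  "svop_inverse A = (\<lambda>u. {x. u \<in> A x})"

definition svop_plus :: "'a::ab_group_add svop \<Rightarrow> 'a svop \<Rightarrow> 'a svop" where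
  "svop_plus A B = (\<lambda>x. {u + v | u v. u \<in> A x \<and> v \<in> B x})"

definition svop_minus :: "'a::ab_group_add svop \<Rightarrow> 'a svop \<Rightarrow> 'a svop" where
  "svop_minus A B = (\<lambda>x. {u - v | u v. u \<in> A x \<and> v \<in> B x})"

definition svop_resolvent :: "'a::ab_group_add svop \<Rightarrow> 'a svop" where
  "svop_resolvent A = svop_inverse (svop_plus (svop_of id) A)"

definition monotone_svop :: "'a::real_inner svop \<Rightarrow> bool" where
  "monotone_svop A \<longleftrightarrow>
    (\<forall>x u y v. (x, u) \<in> svop_graph A \<and> (y, v) \<in> svop_graph A \<longrightarrow> (x - y) \<bullet> (u - v) \<ge> 0)"

definition maximally_monotone_svop :: "'a::real_inner svop \<Rightarrow> bool" where
  "maximally_monotone_svop A \<longleftrightarrow> monotone_svop A \<and>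
    (\<forall>B. monotone_svop B \<and> svop_graph A \<subseteq> svop_graph B \<longrightarrow> svop_graph B = svop_graph A)"

definition R_op :: "'a::real_inner \<Rightarrow> 'a \<Rightarrow> 'a" where
  "R_op e x = norm x *\<^sub>R e"

definition T_op :: "'a::real_inner \<Rightarrow> 'a \<Rightarrow> 'a" where
  "T_op e x = (1/2) *\<^sub>R x + (1/2) *\<^sub>R R_op e x"

definition A_op :: "'a::real_inner \<Rightarrow> 'a svop" where
  "A_op e = svop_minus (svop_inverse (svop_of (T_op e))) (svop_of id)"

lemma svop_graph_A_op: "svop_graph (A_op e) = {(T_op e y, y - T_op e y) | y. True}"
  by (auto simp: svop_graph_def A_op_def svop_minus_def svop_inverse_def svop_of_def)

lemma svop_resolvent_A_op: "svop_resolvent (A_op e) = svop_of (T_op e)"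
proof -
  have "x \<in> svop_resolvent (A_op e) u \<longleftrightarrow> (x, u - x) \<in> svop_graph (A_op e)" for x u
    by (auto simp: svop_resolvent_def svop_inverse_def svop_plus_def svop_of_def svop_graph_def
        intro!: exI[of _ "u - x"])
  moreover have "(x, u - x) \<in> svop_graph (A_op e) \<longleftrightarrow> x = T_op e u" for x u
    by (auto simp: svop_graph_A_op)
  ultimately show ?thesis
    by (auto simp: svop_of_def fun_eq_iff)
qed

end

theory Submission
  imports Defs
begin

text \<open>
  Points of the graph of \<open>A_op e\<close> are the pairs \<open>(T y, y - T y)\<close>, where \<open>T = T_op e\<close> is
  the midpoint of the identity and \<open>R_op e\<close>.

  Maximal monotonicity is one half of Minty's theorem. Writing \<open>T = (Id + R) / 2\<close>, the inner
  product that decides monotonicity is a quarter of \<open>\<parallel>y - z\<parallel>\<^sup>2 - \<parallel>R y - R z\<parallel>\<^sup>2\<close>, and this is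
  nonnegative because \<open>R\<close> is nonexpansive (lemma \<open>monotone_svop_A_op\<close>). Since the two entries
  of a graph point sum to \<open>y\<close>, and \<open>y\<close> is arbitrary, a monotone operator with such a graph admits
  no proper monotone extension (lemma \<open>maximally_monotone_if_surjective_sum\<close>).

  For the formula, the values of \<open>A_op e\<close> at \<open>x\<close> are the vectors \<open>y - x\<close> with \<open>T y = x\<close>, that is,
  \<open>y = 2 x - \<parallel>y\<parallel> e\<close>. The only unknown is thus the number \<open>t = \<parallel>y\<parallel>\<close>, and it is determined by
  \<open>t \<ge> 0\<close> and \<open>\<parallel>2 x - t e\<parallel> = t\<close>. Squaring gives the quadratic equation
  \<open>(1 - \<parallel>e\<parallel>\<^sup>2) t\<^sup>2 + 4 \<langle>e, x\<rangle> t = 4 \<parallel>x\<parallel>\<^sup>2\<close>. Its leading coefficient is positive and its roots have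
  product \<open>\<le> 0\<close>, and both vanish if \<open>x = 0\<close>; hence only the larger root is admissible
  (lemmas \<open>nonneg_root_iff\<close> and \<open>norm_diff_scaleR_eq_iff\<close>).
\<close>

text \<open>
  The roots have opposite signs unless \<open>q = 0\<close>. In that case they are \<open>0\<close> and \<open>- 4 p / d\<close>, and the
  last hypothesis makes them coincide; without it both would be admissible when \<open>p < 0\<close>.
\<close>

lemma nonneg_root_iff:
  fixes d p q t :: real
  assumes "d > 0" "q \<ge> 0" "q = 0 \<Longrightarrow> p = 0"
  shows "t \<ge> 0 \<and> d * t\<^sup>2 + 4 * p * t = 4 * q \<longleftrightarrow> t = (2 * sqrt (d * q + p\<^sup>2) - 2 * p) / d"
proof -
  define s where "s = sqrt (d * q + p\<^sup>2)"
  have s_sq: "s\<^sup>2 = d * q + p\<^sup>2"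
    using assms by (simp add: s_def)
  have "s \<ge> 0"
    using assms by (simp add: s_def)
  have "\<bar>p\<bar> \<le> s"
    using assms by (simp add: s_def real_le_rsqrt)
  have complete_square: "d * t\<^sup>2 + 4 * p * t = 4 * q \<longleftrightarrow> (d * t + 2 * p)\<^sup>2 = (2 * s)\<^sup>2" for t
  proof -
    have "(d * t + 2 * p)\<^sup>2 - (2 * s)\<^sup>2 = d * (d * t\<^sup>2 + 4 * p * t - 4 * q)"
      by (simp add: power_mult_distrib s_sq) (simp add: power2_eq_square algebra_simps)
    then show ?thesis
      using \<open>d > 0\<close> by (metis eq_iff_diff_eq_0 less_irrefl mult_eq_0_iff)
  qed
  have "t = (2 * s - 2 * p) / d" if "t \<ge> 0" and quad: "d * t\<^sup>2 + 4 * p * t = 4 * q"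
  proof -
    \<comment> \<open>\<open>d * t + 2 * p = - 2 * s\<close> would select the root that is not admissible.\<close>
    have "d * t + 2 * p \<ge> 0"
    proof (cases "t = 0")
      case True
      then show ?thesis
        using quad assms(3) by simp
    next
      case False
      have "t * (d * t + 4 * p) \<ge> 0"
        using quad \<open>q \<ge> 0\<close> by (simp add: power2_eq_square algebra_simps)
      then have "d * t + 4 * p \<ge> 0"
        using False \<open>t \<ge> 0\<close> by (simp add: zero_le_mult_iff)
      moreover have "d * t \<ge> 0"
        using \<open>d > 0\<close> \<open>t \<ge> 0\<close> by simp
      ultimately show ?thesis
        by linarith
    qed
    then have "d * t + 2 * p = 2 * s"
    proof (rule power2_eq_imp_eq[rotated])
      show "(d * t + 2 * p)\<^sup>2 = (2 * s)\<^sup>2"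
        by (rule complete_square[THEN iffD1, OF quad])
      show "2 * s \<ge> 0"
        using \<open>s \<ge> 0\<close> by simp
    qed
    then show ?thesis
      using \<open>d > 0\<close> by (simp add: field_simps)
  qed
  moreover have "t \<ge> 0 \<and> d * t\<^sup>2 + 4 * p * t = 4 * q" if t: "t = (2 * s - 2 * p) / d"
  proof
    show "t \<ge> 0"
      using t \<open>d > 0\<close> \<open>\<bar>p\<bar> \<le> s\<close> by simp
    have "d * t + 2 * p = 2 * s"
      using t \<open>d > 0\<close> by simp
    then show "d * t\<^sup>2 + 4 * p * t = 4 * q"
      using complete_square by simp
  qed
  ultimately show ?thesis
    unfolding s_def by iprover
qed

text \<open>
  Geometrically, the ray from \<open>2 x\<close> in direction \<open>- e\<close>, travelled for time \<open>t\<close> at speed less than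
  one, meets the sphere of radius \<open>t\<close> around the origin exactly once.
\<close>

lemma norm_diff_scaleR_eq_iff:
  fixes e x :: "'a::real_inner"
  assumes "norm e < 1"
  shows "norm (2 *\<^sub>R x - t *\<^sub>R e) = t \<longleftrightarrow>
    t = (2 * sqrt ((1 - (norm e)\<^sup>2) * (norm x)\<^sup>2 + (e \<bullet> x)\<^sup>2) - 2 * (e \<bullet> x)) / (1 - (norm e)\<^sup>2)"
proof -
  have "norm (2 *\<^sub>R x - t *\<^sub>R e) = t \<longleftrightarrow> t \<ge> 0 \<and> (norm (2 *\<^sub>R x - t *\<^sub>R e))\<^sup>2 = t\<^sup>2"
    by (metis norm_ge_zero power2_eq_iff_nonneg)
  also have "(norm (2 *\<^sub>R x - t *\<^sub>R e))\<^sup>2 = 4 * (norm x)\<^sup>2 - 4 * (e \<bullet> x) * t + (norm e)\<^sup>2 * t\<^sup>2"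
    unfolding power2_norm_eq_inner
    by (simp add: inner_diff_left inner_diff_right inner_commute power2_eq_square)
  also have "\<dots> = t\<^sup>2 \<longleftrightarrow> (1 - (norm e)\<^sup>2) * t\<^sup>2 + 4 * (e \<bullet> x) * t = 4 * (norm x)\<^sup>2"
    by (auto simp: algebra_simps)
  also have "t \<ge> 0 \<and> \<dots> \<longleftrightarrow>
    t = (2 * sqrt ((1 - (norm e)\<^sup>2) * (norm x)\<^sup>2 + (e \<bullet> x)\<^sup>2) - 2 * (e \<bullet> x)) / (1 - (norm e)\<^sup>2)"
  proof (rule nonneg_root_iff)
    show "1 - (norm e)\<^sup>2 > 0"
      using assms by (simp add: abs_square_less_1)
  qed auto
  finally show ?thesis .
qed

lemma R_op_nonexpansive:
  assumes "norm e \<le> 1"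
  shows "norm (R_op e y - R_op e z) \<le> norm (y - z)"
proof -
  have "norm (R_op e y - R_op e z) = \<bar>norm y - norm z\<bar> * norm e"
    by (simp add: R_op_def flip: scaleR_diff_left)
  also have "\<dots> \<le> \<bar>norm y - norm z\<bar>"
    using assms by (simp add: mult_left_le)
  also have "\<dots> \<le> norm (y - z)"
    by (rule norm_triangle_ineq3)
  finally show ?thesis .
qed

lemma monotone_svop_A_op:
  assumes "norm e \<le> 1"
  shows "monotone_svop (A_op e)"
proof -
  have "(T_op e y - T_op e z) \<bullet> ((y - T_op e y) - (z - T_op e z)) \<ge> 0" for y z
  proof -
    define a b where "a = y - z" and "b = R_op e y - R_op e z"
    have "T_op e y - T_op e z = (1/2) *\<^sub>R (a + b)"
      by (simp add: T_op_def a_def b_def algebra_simps)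
    moreover have "(y - T_op e y) - (z - T_op e z) = (1/2) *\<^sub>R (a - b)"
    proof -
      have "w = (1/2) *\<^sub>R w + (1/2) *\<^sub>R w" for w :: 'a
        by (simp flip: scaleR_add_left)
      from this[of y] this[of z] show ?thesis
        by (simp add: T_op_def a_def b_def algebra_simps)
    qed
    ultimately have "(T_op e y - T_op e z) \<bullet> ((y - T_op e y) - (z - T_op e z))
        = (1/4) * ((a + b) \<bullet> (a - b))"
      by simp
    moreover have "(a + b) \<bullet> (a - b) = (norm a)\<^sup>2 - (norm b)\<^sup>2"
      by (simp add: power2_norm_eq_inner inner_add_left inner_diff_right inner_commute[of b a])
    moreover have "(norm b)\<^sup>2 \<le> (norm a)\<^sup>2"
      using R_op_nonexpansive[OF assms] by (simp add: a_def b_def)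
    ultimately show ?thesis
      by linarith
  qed
  then show ?thesis
    by (auto simp: monotone_svop_def svop_graph_A_op)
qed

text \<open>
  This is the elementary direction of Minty's theorem. A candidate new graph point \<open>(x, u)\<close> is
  compared with the existing point having the same sum of entries: the two differences are opposite,
  so monotonicity forces both to vanish.
\<close>

lemma maximally_monotone_if_surjective_sum:
  assumes "monotone_svop A"
    and sum: "\<And>w. \<exists>y v. (y, v) \<in> svop_graph A \<and> y + v = w"
  shows "maximally_monotone_svop A"
proof -
  have "(x, u) \<in> svop_graph A"
    if B: "monotone_svop B" "svop_graph A \<subseteq> svop_graph B" and xu: "(x, u) \<in> svop_graph B" for B x u
  proof -
    obtain y v where yv: "(y, v) \<in> svop_graph A" "y + v = x + u"
      using sum by blast
    have "(x - y) \<bullet> (u - v) \<ge> 0"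
      using B xu yv(1) unfolding monotone_svop_def by blast
    moreover have "u - v = - (x - y)"
      using yv(2) by (simp add: algebra_simps)
    ultimately have "(x - y) \<bullet> (x - y) \<le> 0"
      by (metis inner_minus_right neg_0_le_iff_le)
    then have "(x - y) \<bullet> (x - y) = 0"
      using inner_ge_zero by (rule order_antisym)
    then have "x = y"
      by simp
    then show ?thesis
      using yv by simp
  qed
  then show ?thesis
    using assms(1) unfolding maximally_monotone_svop_def by auto
qed

lemma maximally_monotone_svop_A_op:
  assumes "norm e \<le> 1"
  shows "maximally_monotone_svop (A_op e)"
  using monotone_svop_A_op[OF assms]
proof (rule maximally_monotone_if_surjective_sum)
  show "\<exists>y v. (y, v) \<in> svop_graph (A_op e) \<and> y + v = w" for w
    by (rule exI[of _ "T_op e w"], rule exI[of _ "w - T_op e w"]) (auto simp: svop_graph_A_op)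
qed

lemma T_op_eq_iff: "T_op e y = x \<longleftrightarrow> y = 2 *\<^sub>R x - norm y *\<^sub>R e"
proof -
  have "T_op e y = x \<longleftrightarrow> 2 *\<^sub>R T_op e y = 2 *\<^sub>R x"
    by simp
  also have "2 *\<^sub>R T_op e y = y + norm y *\<^sub>R e"
    by (simp add: T_op_def R_op_def scaleR_add_right)
  finally show ?thesis
    by (simp add: eq_diff_eq)
qed

theorem theorem2p3:
  fixes e :: "'a :: {real_inner, complete_space}"
  assumes "(UNIV :: 'a set) \<noteq> {0}"
    and "norm e < 1"
  shows "maximally_monotone_svop (A_op e) \<and>
    (\<forall>x. A_op e x =
      {x + ((2 * (e \<bullet> x) - 2 * sqrt ((1 - (norm e)\<^sup>2) * (norm x)\<^sup>2 + (e \<bullet> x)\<^sup>2))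
            / (1 - (norm e)\<^sup>2)) *\<^sub>R e})"
proof (intro conjI allI)
  show "maximally_monotone_svop (A_op e)"
    using assms(2) by (intro maximally_monotone_svop_A_op) simp
next
  fix x
  define t where
    "t = (2 * sqrt ((1 - (norm e)\<^sup>2) * (norm x)\<^sup>2 + (e \<bullet> x)\<^sup>2) - 2 * (e \<bullet> x)) / (1 - (norm e)\<^sup>2)"
  have t_iff: "norm (2 *\<^sub>R x - s *\<^sub>R e) = s \<longleftrightarrow> s = t" for s
    unfolding t_def by (rule norm_diff_scaleR_eq_iff[OF assms(2)])
  have "T_op e y = x \<longleftrightarrow> y = 2 *\<^sub>R x - t *\<^sub>R e" for y
    unfolding T_op_eq_iff using t_iff by metis
  then have "{y. T_op e y = x} = {2 *\<^sub>R x - t *\<^sub>R e}"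
    by auto
  moreover have "A_op e x = (\<lambda>y. y - x) ` {y. T_op e y = x}"
    by (auto simp: A_op_def svop_minus_def svop_inverse_def svop_of_def)
  ultimately have "A_op e x = {2 *\<^sub>R x - t *\<^sub>R e - x}"
    by simp
  also have "2 *\<^sub>R x - t *\<^sub>R e - x = x + (- t) *\<^sub>R e"
    by (simp add: scaleR_2)
  also have "- t = (2 * (e \<bullet> x) - 2 * sqrt ((1 - (norm e)\<^sup>2) * (norm x)\<^sup>2 + (e \<bullet> x)\<^sup>2))
      / (1 - (norm e)\<^sup>2)"
    by (simp add: t_def minus_divide_left)
  finally show "A_op e x =
      {x + ((2 * (e \<bullet> x) - 2 * sqrt ((1 - (norm e)\<^sup>2) * (norm x)\<^sup>2 + (e \<bullet> x)\<^sup>2))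
            / (1 - (norm e)\<^sup>2)) *\<^sub>R e}" .
qed

end
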